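(* Let $\mathcal{P}=(\mathcal{E},D,c,f_c)$ be a combinatorial sum problem and $E=\{e_1,e_2,\dots,e_k\}\subseteq\mathcal{E}$. Then the optimal objective value of the following linear program (ELL) in the variables $\alpha_1,\dots,\alpha_k$ is equal to the set lower tolerance $l'_{\mathcal{P}}(E)$: maximize $\sum_{i=1}^k\alpha_i$ subject to $\sum_{i:\,e_i\in F}\alpha_i\le f_c(D_{\sim}(E\setminus F;F))-c^\ast$ for all $F\subseteq E$, and $\alpha_i\ge0$ for all $i\in[k]$.
   Context: A combinatorial sum problem (CSP) is a tuple $\mathcal{P}=(\mathcal{E},D,c,f_c)$, where $\mathcal{E}$ is a finite ground set, $D\subseteq 2^{\mathcal{E}}\setminus\{\emptyset\}$ is the set of feasible solutions, $c:\mathcal{E}\to\mathbb{R}$ and $f_c(S)=\sum_{e\in S}c(e)$ for $S\in D$. For $M\subseteq D$, $f_c(M)=\min_{S\in M}f_c(S)$, with $f_c(\emptyset)=\infty$; $c^\ast=f_c(D)$. For $A,B\subseteq\mathcal{E}$: $D_{\sim}(A;B)=\{S\in D: A\cap S=\emptyset,\ B\subseteq S\}$. $[k]=\{1,\dots,k\}$. For $E=\{e_1,\dots,e_k\}$ and $\vec\alpha=(\alpha_1,\dots,\alpha_k)\in\mathbb{R}^k$, $\mathcal{P}_{c_{-\vec\alpha,E}}$ is the CSP with the same $\mathcal{E},D$ and cost function $c_{-\vec\alpha,E}$ with $c_{-\vec\alpha,E}(e_i)=c(e_i)-\alpha_i$ and $c_{-\vec\alpha,E}(e)=c(e)$ for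 $e\notin E$; $f_{c_{-\vec\alpha,E}}(\mathcal{P}_{c_{-\vec\alpha,E}})$ denotes its optimal value. The set lower tolerance is $l'_{\mathcal{P}}(E)=\max\{\alpha\in\mathbb{R}:$ there exists $\vec\alpha=(\alpha_1,\dots,\alpha_k)$ with all $\alpha_i\ge0$, $\alpha=\sum_i\alpha_i$, $f_{c_{-\vec\alpha,E}}(\mathcal{P}_{c_{-\vec\alpha,E}})=c^\ast\}$, with value $\infty$ if this set is unbounded. In the linear program, constraints with infinite right-hand side are dropped, and its optimal value is $\infty$ if it is unbounded. *)

theory Defs
  imports Complex_Main "HOL-Library.Extended_Real"
begin

record 'a csp =
  ground :: "'a set"
  feasible :: "'a set set"
  cost :: "'a \<Rightarrow> real"

definition combinatorial_sum_problem :: "'a csp \<Rightarrow> bool" where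
  "combinatorial_sum_problem P \<longleftrightarrow>
     finite (ground P) \<and> feasible P \<subseteq> Pow (ground P) - {{}}"

definition solution_cost :: "('a \<Rightarrow> real) \<Rightarrow> 'a set \<Rightarrow> real" where
  "solution_cost c S = (\<Sum>e\<in>S. c e)"

definition min_cost :: "('a \<Rightarrow> real) \<Rightarrow> 'a set set \<Rightarrow> ereal" where
  "min_cost c M = (if M = {} then \<infinity> else ereal (Min (solution_cost c ` M)))"

definition optimal_value :: "'a csp \<Rightarrow> ereal" where
  "optimal_value P = min_cost (cost P) (feasible P)"

definition avoid_contain :: "'a csp \<Rightarrow> 'a set \<Rightarrow> 'a set \<Rightarrow> 'a set set" where
  "avoid_contain P A B = {S \<in> feasible P. A \<inter> S = {} \<and> B \<subseteq> S}"

text \<open>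
  A vector \<open>(\<alpha>\<^sub>1, \<dots>, \<alpha>\<^sub>k)\<close> attached to \<open>E = {e\<^sub>1, \<dots>, e\<^sub>k}\<close> is represented by a function
  \<open>\<alpha>\<close> on elements, with \<open>\<alpha> e\<^sub>i\<close> for \<open>\<alpha>\<^sub>i\<close>. Only its values on \<open>E\<close> are ever used.
\<close>

definition decrease_cost :: "'a csp \<Rightarrow> ('a \<Rightarrow> real) \<Rightarrow> 'a set \<Rightarrow> 'a csp" where
  "decrease_cost P \<alpha> E = P\<lparr>cost := (\<lambda>e. if e \<in> E then cost P e - \<alpha> e else cost P e)\<rparr>"

definition tolerated_decreases :: "'a csp \<Rightarrow> 'a set \<Rightarrow> real set" where
  "tolerated_decreases P E =
     {a. \<exists>\<alpha>. (\<forall>e\<in>E. 0 \<le> \<alpha> e) \<and> a = (\<Sum>e\<in>E. \<alpha> e) \<and>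
            optimal_value (decrease_cost P \<alpha> E) = optimal_value P}"

text \<open>
  \<open>GREATEST\<close> is a genuine maximum: it is unspecified if the bounded set fails to
  attain its supremum.
\<close>

definition set_lower_tolerance :: "'a csp \<Rightarrow> 'a set \<Rightarrow> ereal" where
  "set_lower_tolerance P E =
     (if bdd_above (tolerated_decreases P E)
      then ereal (GREATEST a. a \<in> tolerated_decreases P E)
      else \<infinity>)"

text \<open>
  A constraint with right-hand side \<open>\<infinity>\<close> holds trivially, which amounts to dropping it.
  This includes the case of no feasible solutions, since \<open>\<infinity> - \<infinity> = \<infinity>\<close> in \<^typ>\<open>ereal\<close>.
\<close>

definition ELL_feasible :: "'a csp \<Rightarrow> 'a set \<Rightarrow> ('a \<Rightarrow> real) set" where
  "ELL_feasible P E =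
     {\<alpha>. (\<forall>F. F \<subseteq> E \<longrightarrow>
            ereal (\<Sum>e\<in>F. \<alpha> e)
              \<le> min_cost (cost P) (avoid_contain P (E - F) F) - optimal_value P) \<and>
         (\<forall>e\<in>E. 0 \<le> \<alpha> e)}"

text \<open>
  The supremum in \<^typ>\<open>ereal\<close> is \<open>\<infinity>\<close> if the program is unbounded, and the maximum if
  an optimal solution exists.
\<close>

definition ELL_value :: "'a csp \<Rightarrow> 'a set \<Rightarrow> ereal" where
  "ELL_value P E = (SUP \<alpha>\<in>ELL_feasible P E. ereal (\<Sum>e\<in>E. \<alpha> e))"

end

theory Submission
  imports Defs "HOL-Analysis.Function_Topology"
begin

lemma finite_feasible:
  assumes "combinatorial_sum_problem P"
  shows "finite (feasible P)"
  using assms unfolding combinatorial_sum_problem_def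
  by (meson finite_Diff finite_Pow_iff finite_subset)

lemma finite_feasible_member:
  assumes "combinatorial_sum_problem P" "S \<in> feasible P"
  shows "finite S"
  using assms unfolding combinatorial_sum_problem_def
  by (metis DiffD1 PowD finite_subset subsetD)

text \<open>The default \<open>\<infinity>\<close> on the empty set agrees with the vacuous bound,
  so one equivalence covers both branches of \<open>min_cost\<close>.\<close>

lemma le_min_cost_iff:
  assumes "finite M"
  shows "ereal x \<le> min_cost c M \<longleftrightarrow> (\<forall>S\<in>M. x \<le> solution_cost c S)"
  using assms by (auto simp: min_cost_def)

lemma solution_cost_decrease:
  assumes "finite S"
  shows "solution_cost (cost (decrease_cost P \<alpha> E)) S =
           solution_cost (cost P) S - (\<Sum>e\<in>S \<inter> E. \<alpha> e)"
proof -
  have "solution_cost (cost (decrease_cost P \<alpha> E)) S =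
          (\<Sum>e\<in>S. cost P e - (if e \<in> E then \<alpha> e else 0))"
    unfolding solution_cost_def decrease_cost_def by (auto intro!: sum.cong)
  also have "\<dots> = solution_cost (cost P) S - (\<Sum>e\<in>S \<inter> E. \<alpha> e)"
    unfolding solution_cost_def using assms by (simp add: sum_subtractf sum.inter_restrict)
  finally show ?thesis .
qed

text \<open>
  The classes \<open>avoid_contain P (E - F) F\<close> partition the feasible solutions \<open>S\<close>
  according to their trace \<open>F = S \<inter> E\<close>. On each class the decrease is constant.
\<close>

lemma ELL_feasible_iff:
  assumes P: "combinatorial_sum_problem P"
    and opt: "optimal_value P = ereal m"
  shows "\<alpha> \<in> ELL_feasible P E \<longleftrightarrow>
    (\<forall>e\<in>E. 0 \<le> \<alpha> e) \<and>
    (\<forall>S\<in>feasible P. (\<Sum>e\<in>S \<inter> E. \<alpha> e) \<le> solution_cost (cost P) S - m)"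
proof -
  have fin: "finite (avoid_contain P A B)" for A B
    using finite_feasible[OF P] by (simp add: avoid_contain_def)
  have constraint: "ereal x \<le> min_cost (cost P) M - optimal_value P \<longleftrightarrow>
      (\<forall>S\<in>M. x \<le> solution_cost (cost P) S - m)" if "finite M" for x M
  proof -
    \<comment> \<open>Moving the optimum across the inequality is sound because \<open>m\<close> is
      real. If \<open>min_cost\<close> is \<open>\<infinity>\<close>, both sides hold.\<close>
    have "ereal x \<le> min_cost (cost P) M - optimal_value P \<longleftrightarrow>
            ereal (x + m) \<le> min_cost (cost P) M"
      unfolding opt by (cases "min_cost (cost P) M") auto
    also have "\<dots> \<longleftrightarrow> (\<forall>S\<in>M. x \<le> solution_cost (cost P) S - m)"
      using that by (auto simp: le_min_cost_iff algebra_simps)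
    finally show ?thesis .
  qed
  have trace: "S \<in> avoid_contain P (E - F) F \<longleftrightarrow> S \<in> feasible P \<and> S \<inter> E = F"
    if "F \<subseteq> E" for S F
    using that by (auto simp: avoid_contain_def)
  show ?thesis
    \<comment> \<open>Ranging over \<open>F \<subseteq> E\<close> and then over the class of
      \<open>F\<close> visits each feasible \<open>S\<close> exactly once, at
      \<open>F = S \<inter> E\<close>.\<close>
    unfolding ELL_feasible_def mem_Collect_eq constraint[OF fin]
    by (auto simp: trace)
qed

text \<open>A nonnegative decrease never raises the optimum, so equality reduces to the lower bound
  \<open>m\<close> on the new costs, which can be tested one solution at a time.\<close>

lemma optimal_value_decrease_iff:
  assumes P: "combinatorial_sum_problem P"
    and opt: "optimal_value P = ereal m"
    and nonneg: "\<forall>e\<in>E. 0 \<le> \<alpha> e"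
  shows "optimal_value (decrease_cost P \<alpha> E) = optimal_value P \<longleftrightarrow>
    (\<forall>S\<in>feasible P. (\<Sum>e\<in>S \<inter> E. \<alpha> e) \<le> solution_cost (cost P) S - m)"
proof -
  let ?Q = "decrease_cost P \<alpha> E"
  have [simp]: "feasible ?Q = feasible P"
    by (simp add: decrease_cost_def)
  have fin: "finite (feasible P)"
    by (rule finite_feasible[OF P])
  have ne: "feasible P \<noteq> {}" and m: "m = Min (solution_cost (cost P) ` feasible P)"
    using opt by (auto simp: optimal_value_def min_cost_def split: if_splits)
  have "m \<in> solution_cost (cost P) ` feasible P"
    unfolding m using fin ne by (intro Min_in) auto
  then obtain S where S: "S \<in> feasible P" "m = solution_cost (cost P) S"
    by auto
  \<comment> \<open>An old optimal solution stays feasible and does not become more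
    expensive.\<close>
  have "solution_cost (cost ?Q) S \<le> m"
    using S nonneg by (auto simp: solution_cost_decrease[OF finite_feasible_member[OF P]] intro!: sum_nonneg)
  then have "optimal_value ?Q \<le> ereal m"
    using S fin ne by (auto simp: optimal_value_def min_cost_def Min_le_iff)
  then have "optimal_value ?Q = optimal_value P \<longleftrightarrow> ereal m \<le> optimal_value ?Q"
    unfolding opt by auto
  also have "\<dots> \<longleftrightarrow> (\<forall>S\<in>feasible P. m \<le> solution_cost (cost ?Q) S)"
    unfolding optimal_value_def by (simp add: le_min_cost_iff[OF fin])
  also have "\<dots> \<longleftrightarrow> (\<forall>S\<in>feasible P. (\<Sum>e\<in>S \<inter> E. \<alpha> e) \<le> solution_cost (cost P) S - m)"
    by (intro ball_cong refl)
       (auto simp: solution_cost_decrease[OF finite_feasible_member[OF P]])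
  finally show ?thesis .
qed

text \<open>With a finite optimum, both sides are governed by the same inequalities over feasible
  solutions. Hence the tolerance and the program optimize over one and the same set of
  reals.\<close>

lemma tolerated_decreases_eq:
  assumes P: "combinatorial_sum_problem P"
  shows "tolerated_decreases P E = (\<lambda>\<alpha>. \<Sum>e\<in>E. \<alpha> e) ` ELL_feasible P E"
proof (cases "feasible P = {}")
  case True
  \<comment> \<open>Without feasible solutions every decrease leaves the optimum at
    \<open>\<infinity>\<close>, and every program constraint has right-hand side
    \<open>\<infinity> - \<infinity> = \<infinity>\<close>.\<close>
  then have "optimal_value (decrease_cost P \<alpha> E) = optimal_value P" for \<alpha>
    by (simp add: optimal_value_def min_cost_def decrease_cost_def)
  moreover have "ELL_feasible P E = {\<alpha>. \<forall>e\<in>E. 0 \<le> \<alpha> e}"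
    using True by (auto simp: ELL_feasible_def optimal_value_def min_cost_def avoid_contain_def)
  ultimately show ?thesis
    by (auto simp: tolerated_decreases_def)
next
  case False
  then obtain m where m: "optimal_value P = ereal m"
    by (auto simp: optimal_value_def min_cost_def)
  show ?thesis
    using optimal_value_decrease_iff[OF P m]
    unfolding tolerated_decreases_def ELL_feasible_iff[OF P m] image_def Bex_def by blast
qed

text \<open>The topology on functions is the product topology: coordinates, and so their sums, are
  continuous, and each inequality cuts out a closed set.\<close>

lemma closed_nonneg_polyhedron:
  fixes b :: "'i \<Rightarrow> real"
  shows "closed {\<alpha> :: 'a \<Rightarrow> real. (\<forall>e\<in>E. 0 \<le> \<alpha> e) \<and> (\<forall>i\<in>I. (\<Sum>e\<in>T i. \<alpha> e) \<le> b i)}"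
proof -
  have "{\<alpha>. (\<forall>e\<in>E. 0 \<le> \<alpha> e) \<and> (\<forall>i\<in>I. (\<Sum>e\<in>T i. \<alpha> e) \<le> b i)} =
      (\<Inter>e\<in>E. {\<alpha>. 0 \<le> \<alpha> e}) \<inter> (\<Inter>i\<in>I. {\<alpha>. (\<Sum>e\<in>T i. \<alpha> e) \<le> b i})"
    by auto
  then show ?thesis
    by (simp only:) (intro closed_Int closed_INT ballI closed_Collect_le continuous_on_sum
      continuous_on_const continuous_on_product_coordinates)
qed

text \<open>
  Only the coordinates in \<open>E\<close> matter, so we may set the others to \<open>0\<close>. Nonnegativity and a
  bound on the objective then confine the vectors to a compact box.
\<close>

lemma nonneg_polyhedron_attains_sup:
  fixes b :: "'i \<Rightarrow> real" and E :: "'a set" and I :: "'i set" and T :: "'i \<Rightarrow> 'a set"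
  defines "X \<equiv> {\<alpha> :: 'a \<Rightarrow> real. (\<forall>e\<in>E. 0 \<le> \<alpha> e) \<and> (\<forall>i\<in>I. (\<Sum>e\<in>T i. \<alpha> e) \<le> b i)}"
  assumes E: "finite E" and T: "\<And>i. i \<in> I \<Longrightarrow> T i \<subseteq> E"
    and ne: "X \<noteq> {}" and bdd: "bdd_above ((\<lambda>\<alpha>. \<Sum>e\<in>E. \<alpha> e) ` X)"
  shows "\<exists>\<alpha>\<in>X. \<forall>\<beta>\<in>X. (\<Sum>e\<in>E. \<beta> e) \<le> (\<Sum>e\<in>E. \<alpha> e)"
proof -
  obtain B where B: "\<And>\<alpha>. \<alpha> \<in> X \<Longrightarrow> (\<Sum>e\<in>E. \<alpha> e) \<le> B"
    using bdd by (auto simp: bdd_above_def)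
  \<comment> \<open>By Tychonoff the box is compact even when the type \<open>'a\<close> is
    infinite; the factors outside \<open>E\<close> are singletons.\<close>
  define K where "K = Pi\<^sub>E UNIV (\<lambda>e. if e \<in> E then {0..B} else {0})"
  have "compact K"
    using compactin_PiE[of "\<lambda>_. euclidean" UNIV "\<lambda>e. if e \<in> E then {0..B} else {0}"]
    by (simp add: K_def euclidean_product_topology)
  then have cpt: "compact (K \<inter> X)"
    unfolding X_def by (intro compact_Int_closed closed_nonneg_polyhedron)
  define r where "r \<beta> = (\<lambda>e. if e \<in> E then \<beta> e else 0)" for \<beta> :: "'a \<Rightarrow> real"
  have r_sum: "(\<Sum>e\<in>F. r \<beta> e) = (\<Sum>e\<in>F. \<beta> e)" if "F \<subseteq> E" for F \<beta>
    using that by (intro sum.cong) (auto simp: r_def)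
  have r_in: "r \<beta> \<in> K \<inter> X" if "\<beta> \<in> X" for \<beta>
  proof -
    have pos: "0 \<le> \<beta> e" if "e \<in> E" for e
      using \<open>\<beta> \<in> X\<close> that by (auto simp: X_def)
    \<comment> \<open>A single coordinate is at most the sum of the nonnegative coordinates, which
      is at most \<open>B\<close>.\<close>
    have "\<beta> e \<le> B" if "e \<in> E" for e
      using member_le_sum[OF that, of \<beta>] pos E B[OF \<open>\<beta> \<in> X\<close>] by force
    moreover have "r \<beta> \<in> X"
      using that T by (auto simp: X_def r_sum) (simp add: r_def)
    ultimately show ?thesis
      using pos by (auto simp: K_def r_def)
  qed
  have "continuous_on (K \<inter> X) (\<lambda>\<alpha>. \<Sum>e\<in>E. \<alpha> e)"
    by (intro continuous_on_sum continuous_on_subset[OF continuous_on_product_coordinates subset_UNIV])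
  moreover have "K \<inter> X \<noteq> {}"
    using ne r_in by blast
  ultimately obtain \<alpha> where \<alpha>: "\<alpha> \<in> K \<inter> X"
    and max: "\<And>\<beta>. \<beta> \<in> K \<inter> X \<Longrightarrow> (\<Sum>e\<in>E. \<beta> e) \<le> (\<Sum>e\<in>E. \<alpha> e)"
    using continuous_attains_sup[OF cpt, of "\<lambda>\<alpha>. \<Sum>e\<in>E. \<alpha> e"] by blast
  have "(\<Sum>e\<in>E. \<beta> e) \<le> (\<Sum>e\<in>E. \<alpha> e)" if "\<beta> \<in> X" for \<beta>
    using max[OF r_in[OF that]] by (simp add: r_sum)
  then show ?thesis
    using \<alpha> by blast
qed

text \<open>Gives one polyhedral form for both cases: \<open>m\<close> is the optimum if there is a
  feasible solution, and any real otherwise. The lower bound on the costs later makes the zero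
  vector feasible.\<close>

lemma ELL_feasible_polyhedron:
  assumes P: "combinatorial_sum_problem P"
  obtains m where "ELL_feasible P E = {\<alpha>. (\<forall>e\<in>E. 0 \<le> \<alpha> e) \<and>
      (\<forall>S\<in>feasible P. (\<Sum>e\<in>S \<inter> E. \<alpha> e) \<le> solution_cost (cost P) S - m)}"
    and "\<forall>S\<in>feasible P. m \<le> solution_cost (cost P) S"
proof (cases "feasible P = {}")
  case True
  then show ?thesis
    by (intro that)
      (auto simp: ELL_feasible_def optimal_value_def min_cost_def avoid_contain_def)
next
  case False
  then obtain m where m: "optimal_value P = ereal m"
    by (auto simp: optimal_value_def min_cost_def)
  then have "\<forall>S\<in>feasible P. m \<le> solution_cost (cost P) S"
    using le_min_cost_iff[OF finite_feasible[OF P]] by (metis optimal_value_def order_refl)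
  then show ?thesis
    using ELL_feasible_iff[OF P m] by (intro that[of m]) auto
qed

lemma ELL_attains_max:
  assumes P: "combinatorial_sum_problem P" and E: "finite E"
    and bdd: "bdd_above ((\<lambda>\<alpha>. \<Sum>e\<in>E. \<alpha> e) ` ELL_feasible P E)"
  shows "\<exists>\<alpha>\<in>ELL_feasible P E. \<forall>\<beta>\<in>ELL_feasible P E. (\<Sum>e\<in>E. \<beta> e) \<le> (\<Sum>e\<in>E. \<alpha> e)"
proof -
  obtain m where eq: "ELL_feasible P E = {\<alpha>. (\<forall>e\<in>E. 0 \<le> \<alpha> e) \<and>
      (\<forall>S\<in>feasible P. (\<Sum>e\<in>S \<inter> E. \<alpha> e) \<le> solution_cost (cost P) S - m)}"
    and m: "\<forall>S\<in>feasible P. m \<le> solution_cost (cost P) S"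
    using ELL_feasible_polyhedron[OF P] .
  have "(\<lambda>_. 0) \<in> ELL_feasible P E"
    using m by (simp add: eq)
  then have "ELL_feasible P E \<noteq> {}"
    by blast
  then show ?thesis
    \<comment> \<open>The constraints are indexed by the feasible solutions \<open>S\<close>, with
      supports \<open>S \<inter> E\<close>.\<close>
    using bdd unfolding eq by (intro nonneg_polyhedron_attains_sup E Int_lower2)
qed

theorem theorem10:
  fixes P :: "'a csp" and E :: "'a set"
  assumes "combinatorial_sum_problem P"
    and "E \<subseteq> ground P"
  shows "ELL_value P E = set_lower_tolerance P E"
proof -
  let ?s = "\<lambda>\<alpha> :: 'a \<Rightarrow> real. \<Sum>e\<in>E. \<alpha> e"
  have tol: "tolerated_decreases P E = ?s ` ELL_feasible P E"
    by (rule tolerated_decreases_eq[OF assms(1)])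
  show ?thesis
  proof (cases "bdd_above (tolerated_decreases P E)")
    case True
    have "finite E"
      using assms by (auto simp: combinatorial_sum_problem_def intro: finite_subset)
    then obtain \<alpha> where \<alpha>: "\<alpha> \<in> ELL_feasible P E"
      and max: "\<And>\<beta>. \<beta> \<in> ELL_feasible P E \<Longrightarrow> ?s \<beta> \<le> ?s \<alpha>"
      using ELL_attains_max[OF assms(1)] True unfolding tol by blast
    have "ELL_value P E = ereal (?s \<alpha>)"
      unfolding ELL_value_def using \<alpha> max by (intro antisym SUP_least SUP_upper) auto
    \<comment> \<open>Attainment is essential here: a mere supremum would leave
      \<open>GREATEST\<close> unspecified.\<close>
    moreover have "(GREATEST a. a \<in> tolerated_decreases P E) = ?s \<alpha>"
      unfolding tol using \<alpha> max by (intro Greatest_equality) auto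
    ultimately show ?thesis
      using True by (simp add: set_lower_tolerance_def)
  next
    case False
    \<comment> \<open>An \<open>ereal\<close> supremum is \<open>\<infinity>\<close> once every
      natural number is reached or exceeded.\<close>
    have "\<exists>\<alpha>\<in>ELL_feasible P E. ereal (real n) \<le> ereal (?s \<alpha>)" for n :: nat
      using False unfolding tol bdd_above_def by (simp add: not_le) (meson less_imp_le)
    then have "ELL_value P E = \<infinity>"
      unfolding ELL_value_def by (intro SUP_PInfty)
    then show ?thesis
      using False by (simp add: set_lower_tolerance_def)
  qed
qed

end
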